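(* Suppose the nonlinear vector Riemannian conjugate gradient method described in the context generates infinite sequences $(x_k),(d_k),(t_k)$. Assume that: (i) there exists a constant $L>0$ such that for all $x\in\mathcal M$, all $d\in T_x\mathcal M$ with $\|d\|=1$ and all $t\ge 0$, $\|\mathrm D(F\circ R_x)(td)[d]-\mathrm D(F\circ R_x)(0)[d]\|\le Lt$; (ii) with $\mathcal L=\{x\in\mathcal M\mid F(x)\preceq_K F(x_0)\}$, whenever $(G_k)_{k\in\mathbb N}\subset F(\mathcal L)$ satisfies $G_{k+1}\preceq_K G_k$ for all $k$, there exists $\mathcal G\in\mathbb R^m$ with $\mathcal G\preceq_K G_k$ for all $k$; (iii) the level set $\mathcal L$ is bounded; (iv) $\sum_{k\ge 0}\frac{1}{\|d_k\|^2}=\infty$. If, for all $k\ge 1$, $0\le\beta_k\le\beta_k^{\mathrm{DY}}$, where $$\beta_k^{\mathrm{DY}}=\frac{-\psi_{x_k,v_k}(0)}{\psi_{x_{k-1},d_{k-1}}(t_{k-1}d_{k-1})-\psi_{x_{k-1},d_{k-1}}(0)},$$ and, for all $k\ge 0$, $t_k$ satisfies the strong Wolfe conditions $$F(R_{x_k}(t_kd_k))\preceq_K F(x_k)+c_1t_k\,\varphi(\mathrm DF(x_k)[d_k])\,e,\qquad |\psi_{x_k,d_k}(t_kd_k)|\le c_2\,|\psi_{x_k,d_k}(0)|,$$ then $\liminf_{k\to\infty}\|v(x_k)\|=0$.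
   Context: $K\subset\mathbb R^m$ is a closed, convex, pointed ($K\cap(-K)=\{0\}$) cone with nonempty interior; $u\preceq_K v$ means $v-u\in K$. $K^*=\{\omega\in\mathbb R^m\mid \omega^Ty\ge 0\ \text{for all } y\in K\}$, and $C\subset K^*\setminus\{0\}$ is a compact set such that $K^*$ is the cone generated by the convex hull of $C$. $\varphi:\mathbb R^m\to\mathbb R$ is $\varphi(y)=\sup\{y^Tw\mid w\in C\}$. $e\in K$ is a fixed vector with $0<\langle\omega,e\rangle\le 1$ for all $\omega\in C$, and $0<c_1<c_2<1$ are fixed constants. $\mathcal M$ is an $n$-dimensional smooth Riemannian manifold; $\|\cdot\|$ is the norm induced by the metric on tangent spaces (and the Euclidean norm on $\mathbb R^m$). $F:\mathcal M\to\mathbb R^m$ is continuously differentiable with derivative $\mathrm DF(x):T_x\mathcal M\to\mathbb R^m$. $R:T\mathcal M\to\mathcal M$ is a retraction, i.e. a smooth map whose restrictions $R_x$ to $T_x\mathcal M$ satisfy $R_x(0_x)=x$ and $\mathrm DR_x(0_x)=\mathrm{id}_{T_x\mathcal M}$. For $x\in\mathcal M$, $v(x)$ is the unique minimizer over $d\in T_x\mathcal M$ of $\varphi(\mathrm DF(x)[d])+\|d\|^2/2$; $v_k:=v(x_k)$. For $x\in\mathcal M$, $d\in T_x\mathcal M$, $t\ge 0$, put $\psi_{x,d}(td):=\varphi\big(\mathrm DF(R_x(td))[\mathrm DR_x(td)[d]]\big)$, so $\psi_{x,d}(0)=\varphi(\mathrm DF(x)[d])$. The nonlinear vector Riemannian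 conjugate gradient method: start from $x_0\in\mathcal M$; at iteration $k$ stop if $v(x_k)=0$; otherwise set $d_0=v(x_0)$ and, for $k\ge 1$, $d_k=v(x_k)+\beta_k\mathcal T^{k-1}(d_{k-1})$, where $\beta_k\in\mathbb R$ is an algorithmic parameter and $\mathcal T^{k-1}(d_{k-1}):=\mathrm DR_{x_{k-1}}(t_{k-1}d_{k-1})[d_{k-1}]\in T_{x_k}\mathcal M$; choose a step size $t_k>0$ and set $x_{k+1}=R_{x_k}(t_kd_k)$. In particular, if infinite sequences are generated then $v(x_k)\ne 0$ for all $k$. *)

theory Defs
  imports "HOL-Analysis.Analysis" "HOL-Library.Function_Algebras"
begin

section \<open>Smooth functions between normed spaces\<close>

(* For S open in a finite-dimensional space this is the usual class C^k, phrased with iterated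
   directional derivatives. *)
primrec Ck_on :: "nat \<Rightarrow> 'a::real_normed_vector set \<Rightarrow> ('a \<Rightarrow> 'b::real_normed_vector) \<Rightarrow> bool" where
  "Ck_on 0 S f \<longleftrightarrow> continuous_on S f"
| "Ck_on (Suc k) S f \<longleftrightarrow> (\<forall>x\<in>S. f differentiable (at x)) \<and>
     (\<forall>v. Ck_on k S (\<lambda>x. frechet_derivative f (at x) v))"

definition smooth_on :: "'a::real_normed_vector set \<Rightarrow> ('a \<Rightarrow> 'b::real_normed_vector) \<Rightarrow> bool" where
  "smooth_on S f \<longleftrightarrow> (\<forall>k. Ck_on k S f)"

section \<open>Smooth manifolds\<close>

(* The manifold is the whole type 'a with its (Hausdorff, second countable) topology. A chart is
   a pair of its domain U and a map that matters on U only; the second component of a chart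
   is a homeomorphism of U onto an open subset of the model space real^'n.
   Any smooth atlas, maximal or not, is admitted: compatible atlases give canonically isomorphic
   tangent spaces and the same smooth maps. *)
type_synonym ('a, 'n) chart = "'a set \<times> ('a \<Rightarrow> real^'n)"

definition chart_image :: "('a, 'n::finite) chart \<Rightarrow> (real^'n) set" where
  "chart_image c = snd c ` fst c"

definition chart_inv :: "('a, 'n::finite) chart \<Rightarrow> real^'n \<Rightarrow> 'a" where
  "chart_inv c = inv_into (fst c) (snd c)"

definition smooth_atlas ::
  "('a::{t2_space,second_countable_topology}, 'n::finite) chart set \<Rightarrow> bool" where
  "smooth_atlas A \<longleftrightarrow>
     (\<Union>c\<in>A. fst c) = UNIV \<and>
     (\<forall>c\<in>A. open (fst c) \<and> open (chart_image c) \<and>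
        homeomorphism (fst c) (chart_image c) (snd c) (chart_inv c)) \<and>
     (\<forall>c\<in>A. \<forall>c'\<in>A. smooth_on (snd c ` (fst c \<inter> fst c')) (snd c' \<circ> chart_inv c))"

(* Only used for objects that do not depend on the chart. *)
definition chart_at :: "('a, 'n::finite) chart set \<Rightarrow> 'a \<Rightarrow> ('a, 'n) chart" where
  "chart_at A x = (SOME c. c \<in> A \<and> x \<in> fst c)"

section \<open>Tangent vectors\<close>

instantiation "fun" :: (type, scaleR) scaleR
begin

definition scaleR_fun :: "real \<Rightarrow> ('a \<Rightarrow> 'b) \<Rightarrow> 'a \<Rightarrow> 'b" where
  "scaleR_fun r f = (\<lambda>x. r *\<^sub>R f x)"

instance ..

end

instance "fun" :: (type, real_vector) real_vector
  by standard (auto simp: scaleR_fun_def plus_fun_def scaleR_add_right scaleR_add_left)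

(* A tangent vector at x is the family of its coordinate vectors in all charts around x, related
   by the Jacobians of the transition maps. The components at other charts are set to 0, so that
   the pointwise operations make the tangent space a linear subspace of the function space. *)
type_synonym ('a, 'n) tangent = "('a, 'n) chart \<Rightarrow> real^'n"

definition tangent_space ::
  "('a, 'n::finite) chart set \<Rightarrow> 'a \<Rightarrow> ('a, 'n) tangent set" where
  "tangent_space A x = {\<xi>.
     (\<forall>c. \<not> (c \<in> A \<and> x \<in> fst c) \<longrightarrow> \<xi> c = 0) \<and>
     (\<forall>c\<in>A. \<forall>c'\<in>A. x \<in> fst c \<and> x \<in> fst c' \<longrightarrow>
        \<xi> c' = frechet_derivative (snd c' \<circ> chart_inv c) (at (snd c x)) (\<xi> c))}"

(* the tangent vector at x whose coordinate vector in the chart c is u *)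
definition tangent_lift ::
  "('a, 'n::finite) chart set \<Rightarrow> 'a \<Rightarrow> ('a, 'n) chart \<Rightarrow> real^'n \<Rightarrow> ('a, 'n) tangent" where
  "tangent_lift A x c u = (\<lambda>c'. if c' \<in> A \<and> x \<in> fst c'
     then frechet_derivative (snd c' \<circ> chart_inv c) (at (snd c x)) u else 0)"

section \<open>Derivatives\<close>

definition C1_map ::
  "('a, 'n::finite) chart set \<Rightarrow> ('a \<Rightarrow> 'b::real_normed_vector) \<Rightarrow> bool" where
  "C1_map A F \<longleftrightarrow> (\<forall>c\<in>A. Ck_on 1 (chart_image c) (F \<circ> chart_inv c))"

(* DF(x)[\<xi>] for F from the manifold to a vector space *)
definition mderiv ::
  "('a, 'n::finite) chart set \<Rightarrow> ('a \<Rightarrow> 'b::real_normed_vector) \<Rightarrow> 'a \<Rightarrow> ('a, 'n) tangent \<Rightarrow> 'b" where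
  "mderiv A F x \<xi> = (let c = chart_at A x in
     frechet_derivative (F \<circ> chart_inv c) (at (snd c x)) (\<xi> c))"

(* Dh(\<eta>)[\<xi>] for h from the vector space T_x M to a normed space, in the linear coordinates of T_x M
   given by a chart *)
definition tderiv ::
  "('a, 'n::finite) chart set \<Rightarrow> 'a \<Rightarrow> (('a, 'n) tangent \<Rightarrow> 'b::real_normed_vector) \<Rightarrow>
   ('a, 'n) tangent \<Rightarrow> ('a, 'n) tangent \<Rightarrow> 'b" where
  "tderiv A x h \<eta> \<xi> = (let c = chart_at A x in
     frechet_derivative (h \<circ> tangent_lift A x c) (at (\<eta> c)) (\<xi> c))"

(* D\<rho>(\<eta>)[\<xi>], a tangent vector at \<rho>(\<eta>), for \<rho> from T_x M to the manifold *)
definition tmderiv ::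
  "('a, 'n::finite) chart set \<Rightarrow> 'a \<Rightarrow> (('a, 'n) tangent \<Rightarrow> 'a) \<Rightarrow>
   ('a, 'n) tangent \<Rightarrow> ('a, 'n) tangent \<Rightarrow> ('a, 'n) tangent" where
  "tmderiv A x \<rho> \<eta> \<xi> = (\<lambda>c'. if c' \<in> A \<and> \<rho> \<eta> \<in> fst c'
     then tderiv A x (snd c' \<circ> \<rho>) \<eta> \<xi> else 0)"

section \<open>Riemannian metrics\<close>

definition riemannian_metric ::
  "('a, 'n::finite) chart set \<Rightarrow> ('a \<Rightarrow> ('a, 'n) tangent \<Rightarrow> ('a, 'n) tangent \<Rightarrow> real) \<Rightarrow> bool" where
  "riemannian_metric A g \<longleftrightarrow>
     (\<forall>x. \<forall>\<xi>\<in>tangent_space A x. \<forall>\<eta>\<in>tangent_space A x.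
        g x \<xi> \<eta> = g x \<eta> \<xi> \<and>
        (\<forall>\<zeta>\<in>tangent_space A x. g x (\<xi> + \<eta>) \<zeta> = g x \<xi> \<zeta> + g x \<eta> \<zeta>) \<and>
        (\<forall>r. g x (r *\<^sub>R \<xi>) \<eta> = r * g x \<xi> \<eta>) \<and>
        (\<xi> \<noteq> 0 \<longrightarrow> g x \<xi> \<xi> > 0)) \<and>
     (\<forall>c\<in>A. \<forall>u w. smooth_on (chart_image c)
        (\<lambda>y. let x = chart_inv c y in g x (tangent_lift A x c u) (tangent_lift A x c w)))"

definition tnorm ::
  "('a \<Rightarrow> ('a, 'n::finite) tangent \<Rightarrow> ('a, 'n) tangent \<Rightarrow> real) \<Rightarrow> 'a \<Rightarrow> ('a, 'n) tangent \<Rightarrow> real" where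
  "tnorm g x \<xi> = sqrt (g x \<xi> \<xi>)"

definition riemannian_manifold ::
  "('a::{t2_space,second_countable_topology}, 'n::finite) chart set \<Rightarrow>
   ('a \<Rightarrow> ('a, 'n) tangent \<Rightarrow> ('a, 'n) tangent \<Rightarrow> real) \<Rightarrow> bool" where
  "riemannian_manifold A g \<longleftrightarrow> smooth_atlas A \<and> riemannian_metric A g"

(* Continuous, and C^1 off a finite set S, which may contain the end points. One-sided
   derivatives at the points of S are not required; this does not change the infimum below. *)
definition piecewise_C1_curve ::
  "('a::topological_space, 'n::finite) chart set \<Rightarrow> (real \<Rightarrow> 'a) \<Rightarrow> bool" where
  "piecewise_C1_curve A \<gamma> \<longleftrightarrow> continuous_on {0..1} \<gamma> \<and>
     (\<exists>S. finite S \<and> {0, 1} \<subseteq> S \<and>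
        (\<forall>c\<in>A. (snd c \<circ> \<gamma>) C1_differentiable_on {s \<in> {0..1} - S. \<gamma> s \<in> fst c}))"

definition velocity ::
  "('a, 'n::finite) chart set \<Rightarrow> (real \<Rightarrow> 'a) \<Rightarrow> real \<Rightarrow> ('a, 'n) tangent" where
  "velocity A \<gamma> s = (\<lambda>c. if c \<in> A \<and> \<gamma> s \<in> fst c
     then vector_derivative (snd c \<circ> \<gamma>) (at s) else 0)"

definition curve_length ::
  "('a, 'n::finite) chart set \<Rightarrow> ('a \<Rightarrow> ('a, 'n) tangent \<Rightarrow> ('a, 'n) tangent \<Rightarrow> real) \<Rightarrow>
   (real \<Rightarrow> 'a) \<Rightarrow> ennreal" where
  "curve_length A g \<gamma> = (\<integral>\<^sup>+s\<in>{0..1}. ennreal (tnorm g (\<gamma> s) (velocity A \<gamma> s)) \<partial>lborel)"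

(* infinite between different connected components *)
definition riemannian_dist ::
  "('a::topological_space, 'n::finite) chart set \<Rightarrow>
   ('a \<Rightarrow> ('a, 'n) tangent \<Rightarrow> ('a, 'n) tangent \<Rightarrow> real) \<Rightarrow> 'a \<Rightarrow> 'a \<Rightarrow> ennreal" where
  "riemannian_dist A g x y =
     (INF \<gamma>\<in>{\<gamma>. piecewise_C1_curve A \<gamma> \<and> \<gamma> 0 = x \<and> \<gamma> 1 = y}. curve_length A g \<gamma>)"

definition riemannian_bounded ::
  "('a::topological_space, 'n::finite) chart set \<Rightarrow>
   ('a \<Rightarrow> ('a, 'n) tangent \<Rightarrow> ('a, 'n) tangent \<Rightarrow> real) \<Rightarrow> 'a set \<Rightarrow> bool" where
  "riemannian_bounded A g S \<longleftrightarrow>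
     (\<exists>B::real. \<forall>x\<in>S. \<forall>y\<in>S. riemannian_dist A g x y \<le> ennreal B)"

section \<open>Retractions\<close>

(* R x is the restriction R_x of R to T_x M. Smoothness of R : TM -> M is expressed in the charts
   (x, \<xi>) |-> (snd c x, \<xi> c) of the tangent bundle; openness of the domains of the local
   representatives is the continuity of R. *)
definition smooth_bundle_map ::
  "('a, 'n::finite) chart set \<Rightarrow> ('a \<Rightarrow> ('a, 'n) tangent \<Rightarrow> 'a) \<Rightarrow> bool" where
  "smooth_bundle_map A R \<longleftrightarrow> (\<forall>c\<in>A. \<forall>c'\<in>A.
     let Rloc = (\<lambda>(y, u). R (chart_inv c y) (tangent_lift A (chart_inv c y) c u));
         W = {(y, u). y \<in> chart_image c \<and> Rloc (y, u) \<in> fst c'}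
     in open W \<and> smooth_on W (snd c' \<circ> Rloc))"

definition manifold_retraction ::
  "('a, 'n::finite) chart set \<Rightarrow> ('a \<Rightarrow> ('a, 'n) tangent \<Rightarrow> 'a) \<Rightarrow> bool" where
  "manifold_retraction A R \<longleftrightarrow> smooth_bundle_map A R \<and>
     (\<forall>x. R x 0 = x \<and> (\<forall>\<xi>\<in>tangent_space A x. tmderiv A x (R x) 0 \<xi> = \<xi>))"

section \<open>Vector optimization\<close>

definition cone_le :: "'b::real_vector set \<Rightarrow> 'b \<Rightarrow> 'b \<Rightarrow> bool" where
  "cone_le K u v \<longleftrightarrow> v - u \<in> K"

definition dual_cone :: "'b::real_inner set \<Rightarrow> 'b set" where
  "dual_cone K = {\<omega>. \<forall>y\<in>K. \<omega> \<bullet> y \<ge> 0}"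

definition support_fun :: "'b::real_inner set \<Rightarrow> 'b \<Rightarrow> real" where
  "support_fun C y = (SUP w\<in>C. y \<bullet> w)"

definition steepest_descent ::
  "('a, 'n::finite) chart set \<Rightarrow> ('a \<Rightarrow> ('a, 'n) tangent \<Rightarrow> ('a, 'n) tangent \<Rightarrow> real) \<Rightarrow>
   ('a \<Rightarrow> 'b::euclidean_space) \<Rightarrow> 'b set \<Rightarrow> 'a \<Rightarrow> ('a, 'n) tangent" where
  "steepest_descent A g F C x =
     (let J = (\<lambda>d. support_fun C (mderiv A F x d) + (tnorm g x d)\<^sup>2 / 2)
      in THE d. d \<in> tangent_space A x \<and> (\<forall>d'\<in>tangent_space A x. J d \<le> J d'))"

(* The argument t stands for the point td of the ray: this is \<psi>_{x,d}(td). *)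
definition psi ::
  "('a, 'n::finite) chart set \<Rightarrow> ('a \<Rightarrow> ('a, 'n) tangent \<Rightarrow> 'a) \<Rightarrow>
   ('a \<Rightarrow> 'b::euclidean_space) \<Rightarrow> 'b set \<Rightarrow> 'a \<Rightarrow> ('a, 'n) tangent \<Rightarrow> real \<Rightarrow> real" where
  "psi A R F C x d t =
     support_fun C (mderiv A F (R x (t *\<^sub>R d)) (tmderiv A x (R x) (t *\<^sub>R d) d))"

end

theory Submission
  imports Defs
begin

text \<open>
  Write \<open>p\<^sub>k = \<phi>(DF(x\<^sub>k)[d\<^sub>k])\<close>, \<open>a\<^sub>k = \<phi>(DF(x\<^sub>k)[v\<^sub>k])\<close> and
  \<open>q\<^sub>k = \<psi>\<^bsub>x\<^sub>k,d\<^sub>k\<^esub>(t\<^sub>k d\<^sub>k)\<close>. Comparing \<open>v\<^sub>k\<close> with \<open>0\<close> in its minimization problem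
  gives \<open>a\<^sub>k \<le> -\<parallel>v\<^sub>k\<parallel>\<^sup>2/2\<close>. Sublinearity of \<open>\<phi>\<close> gives \<open>p\<^sub>k \<le> a\<^sub>k + \<beta>\<^sub>k q\<^sub>k\<^sub>-\<^sub>1\<close>, and the Dai--Yuan bound
  together with the curvature condition turns this into \<open>p\<^sub>k \<le> a\<^sub>k/(1 + c\<^sub>2)\<close>. By (i) and the
  curvature condition, \<open>t\<^sub>k \<parallel>d\<^sub>k\<parallel>\<^sup>2\<close> is at least a constant times \<open>-p\<^sub>k\<close>; inserting this into the
  decrease condition, tested against one \<open>\<omega> \<in> C\<close>, and telescoping yields the Zoutendijk condition
  \<open>\<Sum> p\<^sub>k\<^sup>2/\<parallel>d\<^sub>k\<parallel>\<^sup>2 < \<infinity>\<close>. If \<open>\<parallel>v\<^sub>k\<parallel>\<close> stayed away from \<open>0\<close>, so would \<open>p\<^sub>k\<close>, contradicting (iv).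
\<close>

section \<open>Charts and tangent vectors\<close>

lemma chart_homeomorphism:
  assumes "smooth_atlas A" "c \<in> A"
  shows "homeomorphism (fst c) (chart_image c) (snd c) (chart_inv c)" "open (fst c)" "open (chart_image c)"
  using assms by (auto simp: smooth_atlas_def)

lemma chart_inv_chart:
  assumes "smooth_atlas A" "c \<in> A" "x \<in> fst c"
  shows "chart_inv c (snd c x) = x"
  using chart_homeomorphism(1)[OF assms(1,2)] assms(3) by (auto simp: homeomorphism_def)

lemma chart_at_mem:
  assumes "smooth_atlas A"
  shows "chart_at A x \<in> A" "x \<in> fst (chart_at A x)"
proof -
  have "\<exists>c. c \<in> A \<and> x \<in> fst c"
    using assms unfolding smooth_atlas_def by blast
  from someI_ex[OF this] show "chart_at A x \<in> A" "x \<in> fst (chart_at A x)"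
    unfolding chart_at_def by auto
qed

lemma open_chart_overlap:
  assumes "smooth_atlas A" "c \<in> A" "c' \<in> A"
  shows "open (snd c ` (fst c \<inter> fst c'))"
proof -
  note H = chart_homeomorphism[OF assms(1,2)]
  have "openin (top_of_set (fst c)) (fst c \<inter> fst c')"
    using chart_homeomorphism(2)[OF assms(1,3)] by (auto simp: openin_open)
  then have "openin (top_of_set (chart_image c)) (snd c ` (fst c \<inter> fst c'))"
    using homeomorphism_imp_open_map[OF H(1)] by blast
  then show ?thesis
    using H(3) openin_open_eq by blast
qed

lemma smooth_on_has_derivative:
  assumes "smooth_on S f" "z \<in> S"
  shows "(f has_derivative frechet_derivative f (at z)) (at z)"
proof -
  have "Ck_on (Suc 0) S f" using assms(1) unfolding smooth_on_def by blast
  then have "f differentiable (at z)" using assms(2) by simp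
  then show ?thesis by (simp add: frechet_derivative_works)
qed

lemma transition_has_derivative:
  assumes "smooth_atlas A" "c \<in> A" "c' \<in> A" "x \<in> fst c" "x \<in> fst c'"
  shows "((snd c' \<circ> chart_inv c) has_derivative
    frechet_derivative (snd c' \<circ> chart_inv c) (at (snd c x))) (at (snd c x))"
  using assms by (intro smooth_on_has_derivative[of "snd c ` (fst c \<inter> fst c')"])
    (auto simp: smooth_atlas_def)

text \<open>Near \<open>z\<close> the map \<open>h \<circ> f\<close> equals
  \<open>(h \<circ> chart_inv c) \<circ> (snd c \<circ> f)\<close>, so the Euclidean chain rule
  applies. The neighbourhood \<open>N\<close> matters because \<open>chart_inv c\<close> undoes
  \<open>snd c\<close> only on the chart domain.\<close>

lemma has_derivative_via_chart:
  assumes "smooth_atlas A" "c \<in> A"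
    and N: "open N" "z \<in> N" "\<And>w. w \<in> N \<Longrightarrow> f w \<in> fst c"
    and f: "((snd c \<circ> f) has_derivative f') (at z)"
    and h: "((h \<circ> chart_inv c) has_derivative h') (at (snd c (f z)))"
  shows "((h \<circ> f) has_derivative (h' \<circ> f')) (at z)"
proof -
  have "((h \<circ> chart_inv c) \<circ> (snd c \<circ> f) has_derivative (h' \<circ> f')) (at z)"
    using f h by (intro diff_chain_at) auto
  then show ?thesis
    by (rule has_derivative_transform_within_open[OF _ N(1,2)])
      (use chart_inv_chart[OF assms(1,2)] N(3) in auto)
qed

text \<open>Chain rule for the transition from \<open>c\<close> to \<open>c''\<close> factored
  through \<open>c'\<close>. This is what makes lifts compatible across charts.\<close>

lemma transition_cocycle:
  assumes "smooth_atlas A" "c \<in> A" "c' \<in> A" "c'' \<in> A"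
    and x: "x \<in> fst c" "x \<in> fst c'" "x \<in> fst c''"
  shows "frechet_derivative (snd c'' \<circ> chart_inv c) (at (snd c x)) =
    frechet_derivative (snd c'' \<circ> chart_inv c') (at (snd c' x)) \<circ>
    frechet_derivative (snd c' \<circ> chart_inv c) (at (snd c x))"
proof (rule sym, rule frechet_derivative_at, rule has_derivative_via_chart[OF assms(1,3)])
  show "open (snd c ` (fst c \<inter> fst c'))" using assms by (intro open_chart_overlap)
  show "snd c x \<in> snd c ` (fst c \<inter> fst c')" using x by auto
  show "\<And>w. w \<in> snd c ` (fst c \<inter> fst c') \<Longrightarrow> chart_inv c w \<in> fst c'"
    using chart_inv_chart[OF assms(1,2)] by auto
  show "((snd c' \<circ> chart_inv c) has_derivative
    frechet_derivative (snd c' \<circ> chart_inv c) (at (snd c x))) (at (snd c x))"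
    using assms by (intro transition_has_derivative)
  show "((snd c'' \<circ> chart_inv c') has_derivative
    frechet_derivative (snd c'' \<circ> chart_inv c') (at (snd c' x))) (at (snd c' (chart_inv c (snd c x))))"
    using transition_has_derivative[OF assms(1,3,4) x(2,3)] chart_inv_chart[OF assms(1,2) x(1)] by simp
qed

lemma tangent_spaceI:
  assumes "\<And>c. \<not> (c \<in> A \<and> x \<in> fst c) \<Longrightarrow> \<xi> c = 0"
    and "\<And>c c'. c \<in> A \<Longrightarrow> c' \<in> A \<Longrightarrow> x \<in> fst c \<Longrightarrow> x \<in> fst c' \<Longrightarrow>
      \<xi> c' = frechet_derivative (snd c' \<circ> chart_inv c) (at (snd c x)) (\<xi> c)"
  shows "\<xi> \<in> tangent_space A x"
  using assms unfolding tangent_space_def by blast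

lemma tangent_space_outside:
  assumes "\<xi> \<in> tangent_space A x" "\<not> (c \<in> A \<and> x \<in> fst c)"
  shows "\<xi> c = 0"
  using assms unfolding tangent_space_def by blast

lemma tangent_space_transition:
  assumes "\<xi> \<in> tangent_space A x" "c \<in> A" "c' \<in> A" "x \<in> fst c" "x \<in> fst c'"
  shows "\<xi> c' = frechet_derivative (snd c' \<circ> chart_inv c) (at (snd c x)) (\<xi> c)"
  using assms unfolding tangent_space_def by blast

lemma tangent_lift_same_chart:
  assumes "smooth_atlas A" "c \<in> A" "x \<in> fst c"
  shows "tangent_lift A x c u c = u"
proof -
  note H = chart_homeomorphism[OF assms(1,2)]
  \<comment> \<open>The composite is known to be the identity only on \<open>chart_image c\<close>,
    hence the detour through an open set.\<close>
  have "((snd c \<circ> chart_inv c) has_derivative id) (at (snd c x))"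
  proof (rule has_derivative_transform_within_open[OF _ H(3)])
    show "(id has_derivative id) (at (snd c x))" by (rule has_derivative_id)
    show "snd c x \<in> chart_image c" using assms(3) by (simp add: chart_image_def)
  qed (use H(1) in \<open>auto simp: homeomorphism_def\<close>)
  then have "id = frechet_derivative (snd c \<circ> chart_inv c) (at (snd c x))"
    by (rule frechet_derivative_at)
  from fun_cong[OF this, of u] show ?thesis
    using assms by (simp add: tangent_lift_def)
qed

lemma tangent_lift_mem:
  assumes "smooth_atlas A" "c \<in> A" "x \<in> fst c"
  shows "tangent_lift A x c u \<in> tangent_space A x"
proof (rule tangent_spaceI)
  fix c' c'' assume *: "c' \<in> A" "c'' \<in> A" "x \<in> fst c'" "x \<in> fst c''"
  show "tangent_lift A x c u c'' =
      frechet_derivative (snd c'' \<circ> chart_inv c') (at (snd c' x)) (tangent_lift A x c u c')"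
    using fun_cong[OF transition_cocycle[OF assms(1,2) *(1,2) assms(3) *(3,4)], of u] *
    by (simp add: tangent_lift_def)
qed (auto simp: tangent_lift_def)

text \<open>Together with \<open>tangent_lift_same_chart\<close> and
  \<open>tangent_lift_mem\<close>, this identifies the tangent space with \<open>real^'n\<close>
  through a single chart.\<close>

lemma tangent_lift_component:
  assumes "c \<in> A" "x \<in> fst c" "\<xi> \<in> tangent_space A x"
  shows "tangent_lift A x c (\<xi> c) = \<xi>"
proof
  fix c'
  show "tangent_lift A x c (\<xi> c) c' = \<xi> c'"
    using tangent_space_outside[OF assms(3), of c'] tangent_space_transition[OF assms(3,1) _ assms(2), of c']
    by (simp add: tangent_lift_def)
qed

lemma linear_frechet_transition:
  assumes "smooth_atlas A" "c \<in> A" "c' \<in> A" "x \<in> fst c" "x \<in> fst c'"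
  shows "linear (frechet_derivative (snd c' \<circ> chart_inv c) (at (snd c x)))"
  using transition_has_derivative[OF assms] by (rule has_derivative_linear)

lemma tangent_lift_add:
  assumes "smooth_atlas A" "c \<in> A" "x \<in> fst c"
  shows "tangent_lift A x c (u + w) = tangent_lift A x c u + tangent_lift A x c w"
  using linear_add[OF linear_frechet_transition[OF assms(1,2) _ assms(3)]]
  by (auto simp: tangent_lift_def fun_eq_iff plus_fun_def)

lemma tangent_lift_scaleR:
  assumes "smooth_atlas A" "c \<in> A" "x \<in> fst c"
  shows "tangent_lift A x c (r *\<^sub>R u) = r *\<^sub>R tangent_lift A x c u"
  using linear_scale[OF linear_frechet_transition[OF assms(1,2) _ assms(3)]]
  by (auto simp: tangent_lift_def fun_eq_iff scaleR_fun_def)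

lemma tangent_space_zero:
  assumes "smooth_atlas A"
  shows "0 \<in> tangent_space A x"
  using linear_0[OF linear_frechet_transition[OF assms]]
  by (intro tangent_spaceI) auto

lemma tangent_space_add:
  assumes "smooth_atlas A" "\<xi> \<in> tangent_space A x" "\<eta> \<in> tangent_space A x"
  shows "\<xi> + \<eta> \<in> tangent_space A x"
proof (rule tangent_spaceI)
  fix c c' assume *: "c \<in> A" "c' \<in> A" "x \<in> fst c" "x \<in> fst c'"
  show "(\<xi> + \<eta>) c' = frechet_derivative (snd c' \<circ> chart_inv c) (at (snd c x)) ((\<xi> + \<eta>) c)"
    using tangent_space_transition[OF assms(2) *] tangent_space_transition[OF assms(3) *]
    by (simp add: linear_add[OF linear_frechet_transition[OF assms(1) *]])
qed (simp add: tangent_space_outside[OF assms(2)] tangent_space_outside[OF assms(3)])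

lemma tangent_space_scaleR:
  assumes "smooth_atlas A" "\<xi> \<in> tangent_space A x"
  shows "r *\<^sub>R \<xi> \<in> tangent_space A x"
proof (rule tangent_spaceI)
  fix c c' assume *: "c \<in> A" "c' \<in> A" "x \<in> fst c" "x \<in> fst c'"
  show "(r *\<^sub>R \<xi>) c' = frechet_derivative (snd c' \<circ> chart_inv c) (at (snd c x)) ((r *\<^sub>R \<xi>) c)"
    using tangent_space_transition[OF assms(2) *]
    by (simp add: scaleR_fun_def linear_scale[OF linear_frechet_transition[OF assms(1) *]])
qed (simp add: scaleR_fun_def tangent_space_outside[OF assms(2)])

section \<open>Chain rules\<close>

lemma C1_map_has_derivative:
  assumes "C1_map A F" "c \<in> A" "x \<in> fst c"
  shows "((F \<circ> chart_inv c) has_derivative frechet_derivative (F \<circ> chart_inv c) (at (snd c x)))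
    (at (snd c x))"
proof -
  have "Ck_on (Suc 0) (chart_image c) (F \<circ> chart_inv c)"
    using assms by (simp add: C1_map_def)
  then have "(F \<circ> chart_inv c) differentiable (at (snd c x))"
    using assms(3) by (simp add: chart_image_def)
  then show ?thesis by (simp add: frechet_derivative_works)
qed

lemma linear_mderiv:
  assumes "smooth_atlas A" "C1_map A F"
  shows "mderiv A F x (\<xi> + \<eta>) = mderiv A F x \<xi> + mderiv A F x \<eta>"
    and "mderiv A F x (r *\<^sub>R \<xi>) = r *\<^sub>R mderiv A F x \<xi>"
proof -
  note lin = has_derivative_linear[OF C1_map_has_derivative[OF assms(2) chart_at_mem[OF assms(1)]]]
  show "mderiv A F x (\<xi> + \<eta>) = mderiv A F x \<xi> + mderiv A F x \<eta>"
    using linear_add[OF lin] by (simp add: mderiv_def Let_def plus_fun_def)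
  show "mderiv A F x (r *\<^sub>R \<xi>) = r *\<^sub>R mderiv A F x \<xi>"
    using linear_scale[OF lin] by (simp add: mderiv_def Let_def scaleR_fun_def)
qed

lemma linear_mderiv_lift:
  assumes "smooth_atlas A" "C1_map A F" "c \<in> A" "x \<in> fst c"
  shows "linear (\<lambda>u. mderiv A F x (tangent_lift A x c u))"
  by (rule linearI)
    (simp_all add: linear_mderiv[OF assms(1,2)] tangent_lift_add[OF assms(1,3,4)]
      tangent_lift_scaleR[OF assms(1,3,4)])

text \<open>Smoothness of \<open>R\<close> is given on the whole bundle; composing with the affine
  embedding \<open>i\<close> of the fibre over \<open>x\<close> restricts it to
  \<open>R x\<close>.\<close>

lemma retraction_local:
  assumes A: "smooth_atlas A" and R: "smooth_bundle_map A R"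
    and c: "c \<in> A" "x \<in> fst c" and c': "c' \<in> A"
    and u: "R x (tangent_lift A x c u) \<in> fst c'"
  shows "open {w. R x (tangent_lift A x c w) \<in> fst c'}"
    and "((snd c' \<circ> (R x \<circ> tangent_lift A x c)) has_derivative
      frechet_derivative (snd c' \<circ> (R x \<circ> tangent_lift A x c)) (at u)) (at u)"
proof -
  define Rloc where "Rloc = (\<lambda>(y, u). R (chart_inv c y) (tangent_lift A (chart_inv c y) c u))"
  define W where "W = {(y, u). y \<in> chart_image c \<and> Rloc (y, u) \<in> fst c'}"
  have W: "open W" "smooth_on W (snd c' \<circ> Rloc)"
    using R c(1) c' unfolding smooth_bundle_map_def Let_def Rloc_def W_def by blast+
  define i :: "real^'b \<Rightarrow> (real^'b) \<times> (real^'b)" where "i = (\<lambda>w. (snd c x, w))"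
  have i: "Rloc (i w) = R x (tangent_lift A x c w)" for w
    using chart_inv_chart[OF A c] by (simp add: i_def Rloc_def)
  have iW: "i w \<in> W \<longleftrightarrow> R x (tangent_lift A x c w) \<in> fst c'" for w
    using i[of w] c(2) by (auto simp: W_def i_def chart_image_def)
  have "continuous_on UNIV i" unfolding i_def by (intro continuous_intros)
  then have "open (i -` W)" using W(1) by (simp add: open_vimage)
  moreover have "i -` W = {w. R x (tangent_lift A x c w) \<in> fst c'}"
    by (simp add: vimage_def iW)
  ultimately show "open {w. R x (tangent_lift A x c w) \<in> fst c'}" by simp
  have "(i has_derivative (\<lambda>w. (0, w))) (at u)"
    unfolding i_def by (auto intro!: derivative_eq_intros)
  moreover have "((snd c' \<circ> Rloc) has_derivative frechet_derivative (snd c' \<circ> Rloc) (at (i u))) (at (i u))"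
    using u iW by (intro smooth_on_has_derivative[OF W(2)]) simp
  ultimately have "((snd c' \<circ> Rloc) \<circ> i has_derivative
      frechet_derivative (snd c' \<circ> Rloc) (at (i u)) \<circ> (\<lambda>w. (0, w))) (at u)"
    by (rule diff_chain_at)
  moreover have "(snd c' \<circ> Rloc) \<circ> i = snd c' \<circ> (R x \<circ> tangent_lift A x c)"
    by (simp add: fun_eq_iff i)
  ultimately show "((snd c' \<circ> (R x \<circ> tangent_lift A x c)) has_derivative
      frechet_derivative (snd c' \<circ> (R x \<circ> tangent_lift A x c)) (at u)) (at u)"
    using frechet_derivative_at by metis
qed

text \<open>Source of the chain rules below: taking a chart map for \<open>h\<close> shows that
  \<open>tmderiv\<close> yields tangent vectors, and taking \<open>F\<close> for \<open>h\<close>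
  differentiates the objective along \<open>R x\<close>. The chart \<open>c'\<close> at the image
  point is arbitrary.\<close>

lemma retraction_chain:
  assumes A: "smooth_atlas A" and R: "smooth_bundle_map A R"
    and \<eta>: "\<eta> \<in> tangent_space A x" and c': "c' \<in> A" "R x \<eta> \<in> fst c'"
    and h: "((h \<circ> chart_inv c') has_derivative h') (at (snd c' (R x \<eta>)))"
  shows "tderiv A x (h \<circ> R x) \<eta> \<xi> = h' (tderiv A x (snd c' \<circ> R x) \<eta> \<xi>)"
proof -
  define c where "c = chart_at A x"
  have c: "c \<in> A" "x \<in> fst c" using chart_at_mem[OF A] by (auto simp: c_def)
  have lift: "tangent_lift A x c (\<eta> c) = \<eta>" using c \<eta> by (rule tangent_lift_component)
  let ?f = "R x \<circ> tangent_lift A x c"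
  have "((h \<circ> ?f) has_derivative (h' \<circ> frechet_derivative (snd c' \<circ> ?f) (at (\<eta> c)))) (at (\<eta> c))"
    using retraction_local[OF A R c c'(1), of "\<eta> c"] lift c'(2) h
    by (intro has_derivative_via_chart[OF A c'(1),
          of "{w. R x (tangent_lift A x c w) \<in> fst c'}"]) auto
  from frechet_derivative_at[OF this] show ?thesis
    by (simp add: tderiv_def Let_def c_def[symmetric] o_assoc fun_eq_iff)
qed

lemma tmderiv_mem:
  assumes A: "smooth_atlas A" and R: "smooth_bundle_map A R"
    and \<eta>: "\<eta> \<in> tangent_space A x"
  shows "tmderiv A x (R x) \<eta> \<xi> \<in> tangent_space A (R x \<eta>)"
proof (rule tangent_spaceI)
  fix c c' assume *: "c \<in> A" "c' \<in> A" "R x \<eta> \<in> fst c" "R x \<eta> \<in> fst c'"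
  show "tmderiv A x (R x) \<eta> \<xi> c' =
      frechet_derivative (snd c' \<circ> chart_inv c) (at (snd c (R x \<eta>))) (tmderiv A x (R x) \<eta> \<xi> c)"
    using retraction_chain[OF A R \<eta> *(1,3) transition_has_derivative[OF A *], of \<xi>] *
    by (simp add: tmderiv_def)
qed (auto simp: tmderiv_def)

text \<open>Links the slopes in the curvature condition, written with \<open>mderiv\<close> and
  \<open>tmderiv\<close>, to the derivative of \<open>F \<circ> R x\<close> in the Lipschitz
  hypothesis.\<close>

lemma mderiv_tmderiv:
  assumes A: "smooth_atlas A" and R: "smooth_bundle_map A R" and F: "C1_map A F"
    and \<eta>: "\<eta> \<in> tangent_space A x"
  shows "mderiv A F (R x \<eta>) (tmderiv A x (R x) \<eta> \<xi>) = tderiv A x (F \<circ> R x) \<eta> \<xi>"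
  using retraction_chain[OF A R \<eta> chart_at_mem[OF A]
      C1_map_has_derivative[OF F chart_at_mem[OF A]], of \<xi>] chart_at_mem[OF A]
  by (simp add: mderiv_def tmderiv_def Let_def)

lemma mderiv_tmderiv_zero:
  assumes "smooth_atlas A" "manifold_retraction A R" "\<xi> \<in> tangent_space A x"
  shows "mderiv A F (R x 0) (tmderiv A x (R x) 0 \<xi>) = mderiv A F x \<xi>"
  using assms by (simp add: manifold_retraction_def)

text \<open>The Lipschitz hypothesis concerns unit vectors only; homogeneity in the direction
  carries it over to \<open>d k\<close>.\<close>

lemma tderiv_retraction_scaleR:
  assumes A: "smooth_atlas A" and R: "smooth_bundle_map A R" and F: "C1_map A F"
    and \<eta>: "\<eta> \<in> tangent_space A x"
  shows "tderiv A x (F \<circ> R x) \<eta> (r *\<^sub>R \<xi>) = r *\<^sub>R tderiv A x (F \<circ> R x) \<eta> \<xi>"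
proof -
  define c where "c = chart_at A x"
  define c' where "c' = chart_at A (R x \<eta>)"
  have c: "c \<in> A" "x \<in> fst c" and c': "c' \<in> A" "R x \<eta> \<in> fst c'"
    using chart_at_mem[OF A] by (auto simp: c_def c'_def)
  note Fd = C1_map_has_derivative[OF F c']
  have "R x (tangent_lift A x c (\<eta> c)) \<in> fst c'"
    using tangent_lift_component[OF c \<eta>] c' by simp
  from has_derivative_linear[OF retraction_local(2)[OF A R c c'(1) this]]
  have "tderiv A x (snd c' \<circ> R x) \<eta> (r *\<^sub>R \<xi>) = r *\<^sub>R tderiv A x (snd c' \<circ> R x) \<eta> \<xi>"
    by (simp add: tderiv_def Let_def c_def[symmetric] o_assoc scaleR_fun_def linear_scale)
  then show ?thesis
    using linear_scale[OF has_derivative_linear[OF Fd]]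
    by (simp add: retraction_chain[OF A R \<eta> c' Fd])
qed

section \<open>The support function and the steepest descent direction\<close>

text \<open>Ensures that the supremum in \<open>support_fun\<close> is a genuine one, as the
  conditionally complete order of the reals requires.\<close>

lemma bdd_above_inner_image:
  assumes "compact C"
  shows "bdd_above ((\<lambda>w. y \<bullet> w) ` C)"
  using assms by (intro compact_imp_bounded[THEN bounded_imp_bdd_above] compact_continuous_image
      continuous_intros)

lemma support_fun_ge:
  assumes "compact C" "w \<in> C"
  shows "y \<bullet> w \<le> support_fun C y"
  unfolding support_fun_def using assms by (intro cSUP_upper bdd_above_inner_image)

lemma support_fun_add:
  assumes "compact C" "C \<noteq> {}"
  shows "support_fun C (y + z) \<le> support_fun C y + support_fun C z"
  unfolding support_fun_def[of C "y + z"] using assms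
  by (intro cSUP_least) (auto simp: inner_add_left intro!: add_mono support_fun_ge)

lemma support_fun_scaleR_le:
  assumes "compact C" "C \<noteq> {}" "0 \<le> r"
  shows "support_fun C (r *\<^sub>R y) \<le> r * support_fun C y"
  unfolding support_fun_def[of C "r *\<^sub>R y"] using assms
  by (intro cSUP_least) (auto intro!: mult_left_mono support_fun_ge)

lemma support_fun_zero:
  assumes "C \<noteq> {}"
  shows "support_fun C 0 = 0"
  using assms by (simp add: support_fun_def)

lemma support_fun_scaleR:
  assumes "compact C" "C \<noteq> {}" "0 \<le> r"
  shows "support_fun C (r *\<^sub>R y) = r * support_fun C y"
proof (cases "r = 0")
  case True
  then show ?thesis using support_fun_zero[OF assms(2)] by simp
next
  case False
  then have r: "r > 0" using assms(3) by simp
  \<comment> \<open>The reverse inequality is the one already proved, applied to the factor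
    \<open>1/r\<close> and the vector \<open>r *\<^sub>R y\<close>.\<close>
  have "support_fun C ((1/r) *\<^sub>R (r *\<^sub>R y)) \<le> (1/r) * support_fun C (r *\<^sub>R y)"
    using r by (intro support_fun_scaleR_le assms) simp
  then have "r * support_fun C y \<le> support_fun C (r *\<^sub>R y)"
    using r by (simp add: field_simps)
  then show ?thesis using support_fun_scaleR_le[OF assms, of y] by simp
qed

text \<open>Subadditivity and Cauchy-Schwarz: a norm bound for \<open>C\<close> is a Lipschitz
  constant of the support function.\<close>

lemma support_fun_diff_le:
  assumes "compact C" "C \<noteq> {}" "\<And>w. w \<in> C \<Longrightarrow> norm w \<le> M"
  shows "support_fun C y - support_fun C z \<le> M * norm (y - z)"
proof -
  have "support_fun C (z + (y - z)) \<le> support_fun C z + support_fun C (y - z)"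
    by (intro support_fun_add assms)
  moreover have "support_fun C (y - z) \<le> M * norm (y - z)"
    unfolding support_fun_def
  proof (intro cSUP_least assms)
    fix w assume "w \<in> C"
    have "(y - z) \<bullet> w \<le> norm (y - z) * norm w" by (rule norm_cauchy_schwarz)
    also have "\<dots> \<le> M * norm (y - z)"
      using assms(3)[OF \<open>w \<in> C\<close>] by (simp add: mult.commute mult_right_mono)
    finally show "(y - z) \<bullet> w \<le> M * norm (y - z)" .
  qed
  ultimately show ?thesis by simp
qed

text \<open>Existence: the positive quadratic term dominates the sublinear one far out, so
  minimizing over a large ball suffices. Uniqueness: the quadratic term makes the sum strictly
  convex.\<close>

lemma sublinear_plus_quadratic_ex1_min:
  fixes \<phi> :: "'v::euclidean_space \<Rightarrow> real" and q :: "'v \<Rightarrow> 'v \<Rightarrow> real"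
  assumes sub: "\<And>u w. \<phi> (u + w) \<le> \<phi> u + \<phi> w"
    and hom: "\<And>r u. 0 \<le> r \<Longrightarrow> \<phi> (r *\<^sub>R u) = r * \<phi> u"
    and q: "bilinear q" "\<And>u w. q u w = q w u" "\<And>u. u \<noteq> 0 \<Longrightarrow> q u u > 0"
  shows "\<exists>!u. \<forall>w. \<phi> u + q u u / 2 \<le> \<phi> w + q w w / 2"
proof -
  let ?J = "\<lambda>u. \<phi> u + q u u / 2"
  \<comment> \<open>A finite convex function on a Euclidean space is continuous, so minima over
    compact sets are attained.\<close>
  have "convex_on UNIV \<phi>"
    by (rule convex_onI) (use sub hom in \<open>auto intro: order_trans[OF sub]\<close>)
  then have c\<phi>: "continuous_on S \<phi>" for S
    using convex_on_continuous[of UNIV \<phi>] continuous_on_subset by blast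
  have "bounded_bilinear q" using q(1) by (simp add: bilinear_conv_bounded_bilinear)
  then have cq: "continuous_on S (\<lambda>u. q u u)" for S
    by (rule bounded_bilinear.continuous_on[OF _ continuous_on_id continuous_on_id])
  have sph: "compact (sphere 0 1 :: 'v set)" "(sphere 0 1 :: 'v set) \<noteq> {}" by auto
  obtain b where b: "b \<in> sphere 0 1" "\<And>u. u \<in> sphere 0 1 \<Longrightarrow> q b b \<le> q u u"
    using continuous_attains_inf[OF sph cq] by blast
  obtain a where a: "\<And>u. u \<in> sphere 0 1 \<Longrightarrow> \<phi> a \<le> \<phi> u"
    using continuous_attains_inf[OF sph c\<phi>] by blast
  define m where "m = q b b"
  have "b \<noteq> 0" using b(1) by auto
  then have m: "m > 0" unfolding m_def by (rule q(3))
  \<comment> \<open>The two terms are homogeneous of degree 1 and 2, so their minima on the unit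
    sphere control them everywhere.\<close>
  have J_ge: "?J u \<ge> norm u * \<phi> a + m * (norm u)\<^sup>2 / 2" for u
  proof (cases "u = 0")
    case True
    then show ?thesis using hom[of 0 0] bilinear_lzero[OF q(1)] by simp
  next
    case False
    define z where "z = u /\<^sub>R norm u"
    have z: "z \<in> sphere 0 1" "u = norm u *\<^sub>R z" using False by (auto simp: z_def)
    have "q (r *\<^sub>R z) (r *\<^sub>R z) = r\<^sup>2 * q z z" for r
      by (simp add: bilinear_lmul[OF q(1)] bilinear_rmul[OF q(1)] power2_eq_square)
    from this[of "norm u"] have "q u u = (norm u)\<^sup>2 * q z z"
      unfolding z(2)[symmetric] .
    moreover have "\<phi> u = norm u * \<phi> z" using z(2) hom[of "norm u" z] by simp
    moreover have "norm u * \<phi> a \<le> norm u * \<phi> z" using a[OF z(1)] by (simp add: mult_left_mono)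
    moreover have "m * (norm u)\<^sup>2 \<le> (norm u)\<^sup>2 * q z z"
      using b(2)[OF z(1)] unfolding m_def mult.commute[of "q b b"] by (intro mult_left_mono) auto
    ultimately show ?thesis by simp
  qed
  \<comment> \<open>Beyond this radius the lower bound \<open>J_ge\<close> is nonnegative, and the
    value at \<open>0\<close> is \<open>0\<close>.\<close>
  define r where "r = 2 * \<bar>\<phi> a\<bar> / m"
  have r: "r \<ge> 0" using m by (simp add: r_def)
  have "continuous_on (cball 0 r) ?J" by (intro continuous_intros c\<phi> cq) simp
  then obtain u where u: "u \<in> cball 0 r" "\<And>w. w \<in> cball 0 r \<Longrightarrow> ?J u \<le> ?J w"
    using continuous_attains_inf[of "cball 0 r" ?J] r by auto
  have min: "?J u \<le> ?J w" for w
  proof (cases "w \<in> cball 0 r")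
    case False
    then have w: "norm w > r" by simp
    have "?J u \<le> ?J 0" using u(2)[of 0] r by simp
    also have "?J 0 = 0" using hom[of 0 0] bilinear_lzero[OF q(1)] by simp
    also have "0 \<le> norm w * (\<phi> a + m * norm w / 2)"
    proof -
      have "2 * \<bar>\<phi> a\<bar> \<le> m * norm w" using w m by (simp add: r_def field_simps)
      then show ?thesis by (intro mult_nonneg_nonneg) auto
    qed
    also have "\<dots> \<le> ?J w" using J_ge[of w] by (simp add: algebra_simps power2_eq_square)
    finally show ?thesis .
  qed (use u in auto)
  show ?thesis
  proof (rule ex1I[of _ u])
    show "\<forall>w. ?J u \<le> ?J w" using min by blast
    fix w assume w: "\<forall>z. ?J w \<le> ?J z"
    show "w = u"
    proof (rule ccontr)
      assume "w \<noteq> u"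
      then have pos: "q (w - u) (w - u) > 0" using q(3) by simp
      define z where "z = (1/2) *\<^sub>R (w + u)"
      have "\<phi> z \<le> (\<phi> w + \<phi> u) / 2" using hom[of "1/2" "w + u"] sub[of w u] by (simp add: z_def)
      \<comment> \<open>Parallelogram identity: the midpoint of two distinct minimizers would have a
        strictly smaller value.\<close>
      moreover have "q z z = (q w w + q u u) / 2 - q (w - u) (w - u) / 4"
        using q(2)[of u w]
        by (simp add: z_def bilinear_lmul[OF q(1)] bilinear_rmul[OF q(1)] bilinear_ladd[OF q(1)]
            bilinear_radd[OF q(1)] bilinear_lsub[OF q(1)] bilinear_rsub[OF q(1)] field_simps)
      moreover have "?J w \<le> ?J z" "?J u \<le> ?J z" using w min by blast+
      ultimately show False using pos by (simp add: field_simps)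
    qed
  qed
qed

section \<open>The Riemannian metric on a single tangent space\<close>

lemma metric_scaleR:
  assumes "riemannian_manifold A g" "\<xi> \<in> tangent_space A x"
  shows "g x (r *\<^sub>R \<xi>) (r *\<^sub>R \<xi>) = r\<^sup>2 * g x \<xi> \<xi>"
proof -
  have A: "smooth_atlas A" and G: "riemannian_metric A g"
    using assms by (auto simp: riemannian_manifold_def)
  have r: "r *\<^sub>R \<xi> \<in> tangent_space A x" using A assms(2) by (rule tangent_space_scaleR)
  have "g x (r *\<^sub>R \<xi>) (r *\<^sub>R \<xi>) = r * g x \<xi> (r *\<^sub>R \<xi>)"
    using G assms(2) r unfolding riemannian_metric_def by blast
  also have "g x \<xi> (r *\<^sub>R \<xi>) = g x (r *\<^sub>R \<xi>) \<xi>"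
    using G assms(2) r unfolding riemannian_metric_def by blast
  also have "\<dots> = r * g x \<xi> \<xi>"
    using G assms(2) unfolding riemannian_metric_def by blast
  finally show ?thesis by (simp add: power2_eq_square)
qed

lemma metric_pos:
  assumes "riemannian_manifold A g" "\<xi> \<in> tangent_space A x" "\<xi> \<noteq> 0"
  shows "g x \<xi> \<xi> > 0"
  using assms unfolding riemannian_manifold_def riemannian_metric_def by blast

lemma metric_zero:
  assumes "riemannian_manifold A g"
  shows "g x 0 0 = 0"
  using metric_scaleR[OF assms tangent_space_zero, of x 0] assms
  by (simp add: riemannian_manifold_def)

lemma tnorm_pos:
  assumes "riemannian_manifold A g" "\<xi> \<in> tangent_space A x" "\<xi> \<noteq> 0"
  shows "tnorm g x \<xi> > 0"
  using metric_pos[OF assms] by (simp add: tnorm_def)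

lemma tnorm_scaleR:
  assumes "riemannian_manifold A g" "\<xi> \<in> tangent_space A x"
  shows "tnorm g x (r *\<^sub>R \<xi>) = \<bar>r\<bar> * tnorm g x \<xi>"
  by (simp add: tnorm_def metric_scaleR[OF assms] real_sqrt_mult)

lemma tnorm_power2:
  assumes "riemannian_manifold A g" "\<xi> \<in> tangent_space A x"
  shows "(tnorm g x \<xi>)\<^sup>2 = g x \<xi> \<xi>"
  using metric_pos[OF assms] metric_zero[OF assms(1), of x]
  by (cases "\<xi> = 0") (auto simp: tnorm_def)

lemma bilinear_metric_lift:
  assumes M: "riemannian_manifold A g" and c: "c \<in> A" "x \<in> fst c"
  shows "bilinear (\<lambda>u w. g x (tangent_lift A x c u) (tangent_lift A x c w))"
    and "g x (tangent_lift A x c u) (tangent_lift A x c w) =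
      g x (tangent_lift A x c w) (tangent_lift A x c u)"
proof -
  have A: "smooth_atlas A" and G: "riemannian_metric A g"
    using M by (auto simp: riemannian_manifold_def)
  let ?l = "tangent_lift A x c"
  note l = tangent_lift_mem[OF A c]
  have sym: "g x (?l u) (?l w) = g x (?l w) (?l u)" for u w
    using G l[of u] l[of w] unfolding riemannian_metric_def by blast
  then show "g x (?l u) (?l w) = g x (?l w) (?l u)" .
  have add: "g x (?l (u + u')) (?l w) = g x (?l u) (?l w) + g x (?l u') (?l w)" for u u' w
    using G l[of u] l[of u'] l[of w] unfolding riemannian_metric_def tangent_lift_add[OF A c] by blast
  have scale: "g x (?l (r *\<^sub>R u)) (?l w) = r * g x (?l u) (?l w)" for r u w
    using G l[of u] l[of w] unfolding riemannian_metric_def tangent_lift_scaleR[OF A c] by blast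
  have left: "linear (\<lambda>u. g x (?l u) (?l w))" for w
    by (rule linearI) (auto simp: add scale)
  then have "linear (\<lambda>w. g x (?l u) (?l w))" for u
    by (subst sym)
  with left show "bilinear (\<lambda>u w. g x (?l u) (?l w))"
    by (simp add: bilinear_def)
qed

text \<open>The minimization problem is transported to \<open>real^'n\<close> by the lift of one
  chart, where the Euclidean result applies. This justifies the definite description in
  \<open>steepest_descent\<close>.\<close>

lemma steepest_descent_ex1:
  assumes M: "riemannian_manifold A g" and F: "C1_map A F" and C: "compact C" "C \<noteq> {}"
  defines "J \<equiv> \<lambda>y d. support_fun C (mderiv A F y d) + (tnorm g y d)\<^sup>2 / 2"
  shows "\<exists>!d. d \<in> tangent_space A y \<and> (\<forall>d'\<in>tangent_space A y. J y d \<le> J y d')"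
proof -
  have A: "smooth_atlas A" using M by (simp add: riemannian_manifold_def)
  define c where "c = chart_at A y"
  have c: "c \<in> A" "y \<in> fst c" using chart_at_mem[OF A] by (auto simp: c_def)
  define l where "l = tangent_lift A y c"
  have l: "l u \<in> tangent_space A y" "l u c = u" for u
    using tangent_lift_mem[OF A c] tangent_lift_same_chart[OF A c] by (auto simp: l_def)
  have l_comp: "l (\<xi> c) = \<xi>" if "\<xi> \<in> tangent_space A y" for \<xi>
    using tangent_lift_component[OF c that] by (simp add: l_def)
  have lin: "linear (\<lambda>u. mderiv A F y (l u))"
    unfolding l_def by (rule linear_mderiv_lift[OF A F c])
  have l0: "l u \<noteq> 0" if "u \<noteq> 0" for u
    using that l(2)[of u] by auto
  have J: "J y (l u) = support_fun C (mderiv A F y (l u)) + g y (l u) (l u) / 2" for u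
    by (simp add: J_def tnorm_power2[OF M l(1)])
  have "\<exists>!u. \<forall>w. J y (l u) \<le> J y (l w)"
    unfolding J
  proof (rule sublinear_plus_quadratic_ex1_min[where \<phi> = "\<lambda>u. support_fun C (mderiv A F y (l u))"
        and q = "\<lambda>u w. g y (l u) (l w)"])
    show "bilinear (\<lambda>u w. g y (l u) (l w))"
      unfolding l_def by (rule bilinear_metric_lift(1)[OF M c])
    show "g y (l u) (l w) = g y (l w) (l u)" for u w
      unfolding l_def by (rule bilinear_metric_lift(2)[OF M c])
    show "g y (l u) (l u) > 0" if "u \<noteq> 0" for u
      using that by (intro metric_pos[OF M l(1) l0])
  qed (simp_all add: linear_add[OF lin] linear_scale[OF lin] support_fun_add[OF C]
        support_fun_scaleR[OF C])
  then obtain u where u: "\<And>w. J y (l u) \<le> J y (l w)"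
    and uniq: "\<And>z. (\<And>w. J y (l z) \<le> J y (l w)) \<Longrightarrow> z = u" by metis
  show ?thesis
  proof (rule ex1I[of _ "l u"])
    show "l u \<in> tangent_space A y \<and> (\<forall>d'\<in>tangent_space A y. J y (l u) \<le> J y d')"
      using l(1) u l_comp by metis
    fix d assume d: "d \<in> tangent_space A y \<and> (\<forall>d'\<in>tangent_space A y. J y d \<le> J y d')"
    \<comment> \<open>The coordinate vector of a minimizer minimizes the transported functional, so
      it must be \<open>u\<close>.\<close>
    then have "d c = u" using l(1) l_comp by (intro uniq) auto
    then show "d = l u" using d l_comp by auto
  qed
qed

lemma steepest_descent_slope:
  assumes M: "riemannian_manifold A g" and F: "C1_map A F" and C: "compact C" "C \<noteq> {}"
  defines "v \<equiv> steepest_descent A g F C"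
  shows "v y \<in> tangent_space A y"
    and "support_fun C (mderiv A F y (v y)) \<le> - (tnorm g y (v y))\<^sup>2 / 2"
proof -
  have A: "smooth_atlas A" using M by (simp add: riemannian_manifold_def)
  let ?J = "\<lambda>d. support_fun C (mderiv A F y d) + (tnorm g y d)\<^sup>2 / 2"
  have v: "v y \<in> tangent_space A y \<and> (\<forall>d'\<in>tangent_space A y. ?J (v y) \<le> ?J d')"
    unfolding v_def steepest_descent_def Let_def
    by (rule theI'[OF steepest_descent_ex1[OF M F C]])
  then show "v y \<in> tangent_space A y" by simp
  have "?J (v y) \<le> ?J 0" using v tangent_space_zero[OF A] by blast
  moreover have "mderiv A F y 0 = 0"
    using linear_mderiv(2)[OF A F, of y 0 0] by simp
  ultimately show "support_fun C (mderiv A F y (v y)) \<le> - (tnorm g y (v y))\<^sup>2 / 2"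
    using support_fun_zero[OF C(2)] metric_zero[OF M, of y] by (simp add: tnorm_def)
qed

section \<open>Slopes and step sizes\<close>

text \<open>If \<open>q \<le> 0\<close>, the term \<open>b * q\<close> only lowers the new slope. If
  \<open>q > 0\<close>, the upper bound on \<open>b\<close> is the worst case, and
  \<open>q \<le> - c * p\<close> gives \<open>q - p \<le> (1 + c) * - p\<close>.\<close>

lemma dai_yuan_slope_bound:
  fixes p q a b p' c :: real
  assumes p: "p < 0" "\<bar>q\<bar> \<le> c * \<bar>p\<bar>" and c: "0 < c" "c < 1" and a: "a < 0"
    and b: "0 \<le> b" "b \<le> - a / (q - p)" and p': "p' \<le> a + b * q"
  shows "p' \<le> a / (1 + c)"
proof (cases "q \<le> 0")
  case True
  then have "b * q \<le> 0" using b by (simp add: mult_nonneg_nonpos)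
  then have "p' \<le> a" using p' by simp
  also have "a \<le> a / (1 + c)" using a c by (simp add: field_simps mult_nonpos_nonneg)
  finally show ?thesis .
next
  case False
  then have qp: "q - p > 0" using p by simp
  have "b * q \<le> - a / (q - p) * q" using False by (intro mult_right_mono b(2)) simp
  then have "p' \<le> a + - a / (q - p) * q" using p' by simp
  also have "\<dots> = a * (- p / (q - p))" using qp by (simp add: field_simps)
  also have "\<dots> \<le> a * (1 / (1 + c))"
  proof (rule mult_left_mono_neg)
    show "1 / (1 + c) \<le> - p / (q - p)" using qp c p False by (simp add: field_simps)
  qed (use a in simp)
  finally show ?thesis by simp
qed

text \<open>Multiplying the step size bound by \<open>- p k\<close> bounds each term by a multiple
  of the decrease of \<open>f\<close>, and these decreases telescope to at most
  \<open>f 0 - B\<close>.\<close>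

lemma zoutendijk_summable:
  fixes p n t f :: "nat \<Rightarrow> real"
  assumes p: "\<And>k. p k < 0" and n: "\<And>k. n k > 0" and pos: "\<alpha> > 0" "\<delta> > 0"
    and step: "\<And>k. \<alpha> * - p k \<le> t k * (n k)\<^sup>2"
    and decr: "\<And>k. f (Suc k) \<le> f k + \<delta> * t k * p k" and below: "\<And>k. B \<le> f k"
  shows "summable (\<lambda>k. (p k)\<^sup>2 / (n k)\<^sup>2)"
proof -
  have term_le: "(p k)\<^sup>2 / (n k)\<^sup>2 \<le> (f k - f (Suc k)) / (\<alpha> * \<delta>)" for k
  proof -
    have "\<alpha> * (- p k) * (- p k) \<le> t k * (n k)\<^sup>2 * (- p k)"
      using p[of k] by (intro mult_right_mono step) simp
    then have "\<alpha> * ((p k)\<^sup>2 / (n k)\<^sup>2) \<le> t k * - p k"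
      using n[of k] by (simp add: field_simps power2_eq_square)
    then have "\<delta> * (\<alpha> * ((p k)\<^sup>2 / (n k)\<^sup>2)) \<le> \<delta> * (t k * - p k)"
      using pos by (intro mult_left_mono) auto
    also have "\<dots> \<le> f k - f (Suc k)" using decr[of k] by (simp add: algebra_simps)
    finally show ?thesis using pos by (simp add: pos_le_divide_eq algebra_simps)
  qed
  show ?thesis
  proof (rule summableI_nonneg_bounded)
    fix N
    have "(\<Sum>k<N. (p k)\<^sup>2 / (n k)\<^sup>2) \<le> (\<Sum>k<N. (f k - f (Suc k)) / (\<alpha> * \<delta>))"
      by (intro sum_mono term_le)
    also have "\<dots> = (f 0 - f N) / (\<alpha> * \<delta>)"
      by (simp add: sum_divide_distrib[symmetric] sum_lessThan_telescope')
    also have "\<dots> \<le> (f 0 - B) / (\<alpha> * \<delta>)"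
      using below[of N] pos by (intro divide_right_mono) auto
    finally show "(\<Sum>k<N. (p k)\<^sup>2 / (n k)\<^sup>2) \<le> (f 0 - B) / (\<alpha> * \<delta>)" .
  qed auto
qed

text \<open>If \<open>w\<close> were eventually above some \<gamma> > 0, then
  \<open>(p k)\<^sup>2\<close> would be bounded below, and comparison with the summable series would
  contradict divergence.\<close>

lemma liminf_norm_eq_0I:
  fixes w p n :: "nat \<Rightarrow> real"
  assumes w: "\<And>k. w k \<ge> 0" and \<kappa>: "\<kappa> > 0" and p: "\<And>k. p k \<le> - \<kappa> * (w k)\<^sup>2"
    and zout: "summable (\<lambda>k. (p k)\<^sup>2 / (n k)\<^sup>2)"
    and div: "(\<Sum>k. ennreal (1 / (n k)\<^sup>2)) = \<infinity>"
  shows "liminf (\<lambda>k. ereal (w k)) = 0"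
proof (rule ccontr)
  assume "liminf (\<lambda>k. ereal (w k)) \<noteq> 0"
  moreover have "liminf (\<lambda>k. ereal (w k)) \<ge> 0"
    using w by (intro Liminf_bounded) auto
  ultimately have "0 < liminf (\<lambda>k. ereal (w k))" by simp
  then obtain \<gamma> where \<gamma>: "0 < ereal \<gamma>" "ereal \<gamma> < liminf (\<lambda>k. ereal (w k))"
    using ereal_dense2 by blast
  then have ev: "eventually (\<lambda>k. \<gamma> < w k) sequentially"
    using less_LiminfD by fastforce
  have \<gamma>0: "\<gamma> > 0" using \<gamma> by simp
  \<comment> \<open>Eventual lower bound for \<open>(p k)\<^sup>2\<close>.\<close>
  define m where "m = (\<kappa> * \<gamma>\<^sup>2)\<^sup>2"
  have m: "m > 0" using \<kappa> \<gamma>0 by (simp add: m_def)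
  have "eventually (\<lambda>k. norm (1 / (n k)\<^sup>2) \<le> (p k)\<^sup>2 / (n k)\<^sup>2 / m) sequentially"
    using ev
  proof eventually_elim
    case (elim k)
    have "\<gamma>\<^sup>2 \<le> (w k)\<^sup>2" using elim \<gamma>0 by (intro power_mono) auto
    then have "\<kappa> * \<gamma>\<^sup>2 \<le> \<kappa> * (w k)\<^sup>2" using \<kappa> by simp
    then have "\<kappa> * \<gamma>\<^sup>2 \<le> - p k" using p[of k] by simp
    then have "m \<le> (- p k)\<^sup>2" unfolding m_def using \<kappa> by (intro power_mono) auto
    then have "1 \<le> (p k)\<^sup>2 / m" using m by simp
    then have "1 / (n k)\<^sup>2 \<le> (p k)\<^sup>2 / m / (n k)\<^sup>2" by (intro divide_right_mono) auto
    then show ?case by (simp add: field_simps)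
  qed
  then have "summable (\<lambda>k. 1 / (n k)\<^sup>2)"
    using summable_divide[OF zout] by (rule summable_comparison_test_ev)
  then have "(\<Sum>k. ennreal (1 / (n k)\<^sup>2)) = ennreal (\<Sum>k. 1 / (n k)\<^sup>2)"
    by (intro suminf_ennreal2) auto
  with div show False by simp
qed

section \<open>Convergence of the conjugate gradient method under the Dai-Yuan bound\<close>

theorem theorem4p4:
  fixes A :: "('a::{t2_space,second_countable_topology}, 'n::finite) chart set"
    and g :: "'a \<Rightarrow> ('a, 'n) tangent \<Rightarrow> ('a, 'n) tangent \<Rightarrow> real"
    and R :: "'a \<Rightarrow> ('a, 'n) tangent \<Rightarrow> 'a"
    and F :: "'a \<Rightarrow> real^'m::finite"
    and K C :: "(real^'m) set" and e :: "real^'m" and c1 c2 :: real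
    and x :: "nat \<Rightarrow> 'a" and d :: "nat \<Rightarrow> ('a, 'n) tangent" and t \<beta> :: "nat \<Rightarrow> real"
    and v :: "'a \<Rightarrow> ('a, 'n) tangent" and \<L> :: "'a set"
  assumes K: "closed K" "convex K" "cone K" "K \<inter> uminus ` K = {0}" "interior K \<noteq> {}"
    and C: "C \<subseteq> dual_cone K - {0}" "compact C" "dual_cone K = cone hull (convex hull C)"
    and e: "e \<in> K" "\<And>\<omega>. \<omega> \<in> C \<Longrightarrow> 0 < \<omega> \<bullet> e \<and> \<omega> \<bullet> e \<le> 1"
    and c12: "0 < c1" "c1 < c2" "c2 < 1"
    and M: "riemannian_manifold A g"
    and F: "C1_map A F"
    and R: "manifold_retraction A R"
    and v_def: "v = steepest_descent A g F C"
    (* the method generates infinite sequences *)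
    and nonstop: "\<And>k. v (x k) \<noteq> 0"
    and d0: "d 0 = v (x 0)"
    and d_step: "\<And>k. k \<ge> 1 \<Longrightarrow> d k = v (x k) +
          \<beta> k *\<^sub>R tmderiv A (x (k-1)) (R (x (k-1))) (t (k-1) *\<^sub>R d (k-1)) (d (k-1))"
    and t_pos: "\<And>k. t k > 0"
    and x_step: "\<And>k. x (Suc k) = R (x k) (t k *\<^sub>R d k)"
    (* (i) *)
    and lipschitz: "\<exists>L>0. \<forall>y. \<forall>\<xi>\<in>tangent_space A y. \<forall>s\<ge>0. tnorm g y \<xi> = 1 \<longrightarrow>
          norm (tderiv A y (F \<circ> R y) (s *\<^sub>R \<xi>) \<xi> - tderiv A y (F \<circ> R y) 0 \<xi>) \<le> L * s"
    (* (ii) *)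
    and level_set: "\<L> = {y. cone_le K (F y) (F (x 0))}"
    and bounded_below: "\<And>G :: nat \<Rightarrow> real^'m. (\<And>k. G k \<in> F ` \<L>) \<Longrightarrow>
          (\<And>k. cone_le K (G (Suc k)) (G k)) \<Longrightarrow> \<exists>G'. \<forall>k. cone_le K G' (G k)"
    (* (iii) *)
    and bounded_level_set: "riemannian_bounded A g \<L>"
    (* (iv) *)
    and divergent: "(\<Sum>k. ennreal (1 / (tnorm g (x k) (d k))\<^sup>2)) = \<infinity>"
    and beta: "\<And>k. k \<ge> 1 \<Longrightarrow> 0 \<le> \<beta> k \<and> \<beta> k \<le>
          - psi A R F C (x k) (v (x k)) 0 /
          (psi A R F C (x (k-1)) (d (k-1)) (t (k-1)) - psi A R F C (x (k-1)) (d (k-1)) 0)"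
    and wolfe_decrease: "\<And>k. cone_le K (F (R (x k) (t k *\<^sub>R d k)))
          (F (x k) + (c1 * t k * support_fun C (mderiv A F (x k) (d k))) *\<^sub>R e)"
    and wolfe_curvature: "\<And>k. \<bar>psi A R F C (x k) (d k) (t k)\<bar> \<le> c2 * \<bar>psi A R F C (x k) (d k) 0\<bar>"
  shows "liminf (\<lambda>k. ereal (tnorm g (x k) (v (x k)))) = 0"
proof -
  have A: "smooth_atlas A" using M by (simp add: riemannian_manifold_def)
  have Rs: "smooth_bundle_map A R" and R0: "\<And>y. R y 0 = y"
    using R by (auto simp: manifold_retraction_def)
  \<comment> \<open>The cone hull of the empty set is empty, whereas the dual cone contains
    \<open>0\<close>; so \<open>C\<close> is nonempty.\<close>
  have "0 \<in> dual_cone K" by (simp add: dual_cone_def)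
  then have C0: "C \<noteq> {}" using C(3) by (auto simp: cone_hull_empty)
  note Cc = C(2) C0
  define p where "p k = support_fun C (mderiv A F (x k) (d k))" for k
  define a where "a k = support_fun C (mderiv A F (x k) (v (x k)))" for k
  define T where "T k = tmderiv A (x k) (R (x k)) (t k *\<^sub>R d k) (d k)" for k
  define q where "q k = support_fun C (mderiv A F (x (Suc k)) (T k))" for k
  define n where "n k = tnorm g (x k) (d k)" for k
  define w where "w k = tnorm g (x k) (v (x k))" for k

  have v_mem: "v (x k) \<in> tangent_space A (x k)" for k
    unfolding v_def by (rule steepest_descent_slope(1)[OF M F Cc])
  have w_pos: "w k > 0" for k
    unfolding w_def using nonstop by (intro tnorm_pos[OF M v_mem])
  have a_le: "a k \<le> - (w k)\<^sup>2 / 2" for k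
    unfolding a_def w_def v_def by (rule steepest_descent_slope(2)[OF M F Cc])
  have a_neg: "a k < 0" for k
    using a_le[of k] zero_less_power[OF w_pos[of k], of 2] by linarith
  have d_Suc: "d (Suc k) = v (x (Suc k)) + \<beta> (Suc k) *\<^sub>R T k" for k
    using d_step[of "Suc k"] by (simp add: T_def)
  \<comment> \<open>Tangency passes along the iteration because the transported direction
    \<open>T k\<close> is tangent at \<open>x (Suc k)\<close>.\<close>
  have d_mem: "d k \<in> tangent_space A (x k)" for k
  proof (induction k)
    case 0
    show ?case using d0 v_mem by simp
  next
    case (Suc k)
    have "T k \<in> tangent_space A (x (Suc k))"
      unfolding T_def x_step using Suc by (intro tmderiv_mem[OF A Rs] tangent_space_scaleR[OF A])
    then show ?case
      unfolding d_Suc using v_mem by (intro tangent_space_add[OF A] tangent_space_scaleR[OF A])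
  qed
  \<comment> \<open>The derivative of the retraction at \<open>0\<close> is the identity on tangent
    vectors, hence the membership condition.\<close>
  have psi_zero: "psi A R F C (x k) \<xi> 0 = support_fun C (mderiv A F (x k) \<xi>)"
    if "\<xi> \<in> tangent_space A (x k)" for k \<xi>
    using mderiv_tmderiv_zero[OF A R that, of F] by (simp add: psi_def)
  have psi_t: "psi A R F C (x k) (d k) (t k) = q k" for k
    by (simp add: psi_def q_def T_def x_step)
  have q_le: "\<bar>q k\<bar> \<le> c2 * \<bar>p k\<bar>" for k
    using wolfe_curvature[of k] by (simp add: psi_t psi_zero[OF d_mem] p_def)
  have beta': "0 \<le> \<beta> (Suc k)" "\<beta> (Suc k) \<le> - a (Suc k) / (q k - p k)" for k
    using beta[of "Suc k"] by (simp_all add: psi_t psi_zero[OF d_mem] psi_zero[OF v_mem] p_def a_def)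
  have p_Suc: "p (Suc k) \<le> a (Suc k) + \<beta> (Suc k) * q k" for k
  proof -
    have "p (Suc k) \<le> a (Suc k) + support_fun C (\<beta> (Suc k) *\<^sub>R mderiv A F (x (Suc k)) (T k))"
      unfolding p_def a_def d_Suc linear_mderiv[OF A F] by (rule support_fun_add[OF Cc])
    then show ?thesis using beta'(1)[of k] by (simp add: support_fun_scaleR[OF Cc] q_def)
  qed
  \<comment> \<open>Serves the base case of the next induction, where \<open>d 0 = v (x 0)\<close>;
    dividing a negative number by \<open>1 + c2 > 1\<close> increases it.\<close>
  have a_frac: "a k \<le> a k / (1 + c2)" for k
    using a_neg[of k] c12 by (simp add: field_simps mult_nonneg_nonpos)
  have p_le: "p k \<le> a k / (1 + c2)" for k
  proof (induction k)
    case 0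
    have "p 0 = a 0" by (simp add: p_def a_def d0)
    then show ?case using a_frac[of 0] by simp
  next
    case (Suc k)
    have "a k / (1 + c2) < 0" using a_neg[of k] c12 by (simp add: divide_less_0_iff)
    then have "p k < 0" using Suc by simp
    then show ?case
      using c12 by (intro dai_yuan_slope_bound[OF _ q_le _ _ a_neg beta' p_Suc]) auto
  qed
  have p_neg: "p k < 0" for k
    using p_le[of k] a_neg[of k] c12 by (smt (verit) divide_neg_pos)

  \<comment> \<open>A zero direction would have slope \<open>0\<close>; being nonzero allows
    \<open>d k\<close> to be normalized below.\<close>
  have d_nz: "d k \<noteq> 0" for k
  proof
    assume "d k = 0"
    then have "mderiv A F (x k) (d k) = 0"
      using linear_mderiv(2)[OF A F, of "x k" 0 0] by simp
    then have "p k = 0" using support_fun_zero[OF C0] by (simp add: p_def)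
    then show False using p_neg[of k] by simp
  qed
  have n_pos: "n k > 0" for k
    unfolding n_def using d_nz by (intro tnorm_pos[OF M d_mem])

  obtain M0 where M0: "M0 > 0" "\<And>\<omega>. \<omega> \<in> C \<Longrightarrow> norm \<omega> \<le> M0"
    using compact_imp_bounded[OF C(2)] by (auto simp: bounded_pos)
  obtain L where L: "L > 0" "\<And>y \<xi> s. \<xi> \<in> tangent_space A y \<Longrightarrow> s \<ge> 0 \<Longrightarrow> tnorm g y \<xi> = 1 \<Longrightarrow>
      norm (tderiv A y (F \<circ> R y) (s *\<^sub>R \<xi>) \<xi> - tderiv A y (F \<circ> R y) 0 \<xi>) \<le> L * s"
    using lipschitz by blast
  have step: "(1 - c2) / (M0 * L) * - p k \<le> t k * (n k)\<^sup>2" for k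
  proof -
    \<comment> \<open>Normalized direction, so \<open>t k *\<^sub>R d k\<close> sits at parameter
      \<open>t k * n k\<close> on its ray. One factor \<open>n k\<close> comes from this parameter
      and one from the homogeneity of the derivative, which gives the square in the claim.\<close>
    define \<xi> where "\<xi> = (1 / n k) *\<^sub>R d k"
    have \<xi>: "\<xi> \<in> tangent_space A (x k)" "d k = n k *\<^sub>R \<xi>" "tnorm g (x k) \<xi> = 1"
      using n_pos[of k] tangent_space_scaleR[OF A d_mem]
      by (auto simp: \<xi>_def tnorm_scaleR[OF M d_mem] n_def)
    let ?D = "\<lambda>\<eta> \<zeta>. tderiv A (x k) (F \<circ> R (x k)) \<eta> \<zeta>"
    have td: "t k *\<^sub>R d k \<in> tangent_space A (x k)" by (rule tangent_space_scaleR[OF A d_mem])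
    have "mderiv A F (x (Suc k)) (T k) = ?D (t k *\<^sub>R d k) (d k)"
      unfolding T_def x_step by (rule mderiv_tmderiv[OF A Rs F td])
    also have "\<dots> = n k *\<^sub>R ?D (t k *\<^sub>R d k) \<xi>"
      using tderiv_retraction_scaleR[OF A Rs F td, of "n k" \<xi>] \<xi>(2) by simp
    finally have 1: "mderiv A F (x (Suc k)) (T k) = n k *\<^sub>R ?D ((t k * n k) *\<^sub>R \<xi>) \<xi>"
      using \<xi>(2) by (metis scaleR_scaleR)
    have "mderiv A F (x k) (d k) = ?D 0 (d k)"
      using mderiv_tmderiv[OF A Rs F tangent_space_zero[OF A], of "x k" "d k"]
        mderiv_tmderiv_zero[OF A R d_mem, of F k] by simp
    also have "\<dots> = n k *\<^sub>R ?D 0 \<xi>"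
      using tderiv_retraction_scaleR[OF A Rs F tangent_space_zero[OF A], of "x k" "n k" \<xi>] \<xi>(2) by simp
    finally have 2: "mderiv A F (x k) (d k) = n k *\<^sub>R ?D 0 \<xi>" .
    have "q k - p k \<le> M0 * norm (mderiv A F (x (Suc k)) (T k) - mderiv A F (x k) (d k))"
      unfolding p_def q_def by (rule support_fun_diff_le[OF Cc M0(2)])
    also have "\<dots> = M0 * (n k * norm (?D ((t k * n k) *\<^sub>R \<xi>) \<xi> - ?D 0 \<xi>))"
      unfolding 1 2 using n_pos[of k] by (simp flip: scaleR_diff_right)
    also have "\<dots> \<le> M0 * (n k * (L * (t k * n k)))"
      using M0(1) n_pos[of k] t_pos[of k] by (intro mult_left_mono L(2)[OF \<xi>(1) _ \<xi>(3)]) auto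
    finally have "q k - p k \<le> M0 * L * (t k * (n k)\<^sup>2)"
      by (simp add: power2_eq_square algebra_simps)
    \<comment> \<open>Since \<open>p k < 0\<close>, the curvature condition includes
      \<open>q k \<ge> c2 * p k\<close>.\<close>
    moreover have "(1 - c2) * - p k \<le> q k - p k"
      using q_le[of k] p_neg[of k] by (simp add: algebra_simps)
    ultimately have "(1 - c2) * - p k \<le> M0 * L * (t k * (n k)\<^sup>2)" by linarith
    then show ?thesis using M0(1) L(1) by (simp add: field_simps)
  qed

  have K_add: "y + z \<in> K" if "y \<in> K" "z \<in> K" for y z
    using K(2,3) that convex_cone[of K] by blast
  have decrease: "F (x k) - F (x (Suc k)) + (c1 * t k * p k) *\<^sub>R e \<in> K" for k
    using wolfe_decrease[of k] by (simp add: cone_le_def x_step p_def algebra_simps)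
  \<comment> \<open>Adding back a nonnegative multiple of \<open>e\<close> cancels the negative
    slope term. Hence all iterates stay in the level set and their values form a decreasing sequence
    with a lower bound \<open>G\<close>.\<close>
  have mono: "cone_le K (F (x (Suc k))) (F (x k))" for k
  proof -
    have "(c1 * t k * - p k) *\<^sub>R e \<in> K"
      using c12 t_pos[of k] p_neg[of k] by (intro mem_cone K(3) e(1) mult_nonneg_nonneg) auto
    from K_add[OF decrease[of k] this] show ?thesis by (simp add: cone_le_def)
  qed
  have "x k \<in> \<L>" for k
  proof (induction k)
    case 0
    have "0 \<in> K" using K(4) by auto
    then show ?case by (simp add: level_set cone_le_def)
  next
    case (Suc k)
    then show ?case
      using K_add[of "F (x 0) - F (x k)" "F (x k) - F (x (Suc k))"] mono[of k]
      by (simp add: level_set cone_le_def)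
  qed
  then obtain G where G: "\<And>k. cone_le K G (F (x k))"
    using bounded_below[of "\<lambda>k. F (x k)"] mono by blast

  \<comment> \<open>Pairing with one \<omega> turns the cone inequalities into real ones:
    \<open>\<omega> \<bullet> F (x k)\<close> decreases at the positive rate
    \<open>c1 * (\<omega> \<bullet> e)\<close> and is bounded below by
    \<open>\<omega> \<bullet> G\<close>.\<close>
  obtain \<omega> where \<omega>: "\<omega> \<in> C" using C0 by blast
  then have \<omega>_dual: "\<And>y. y \<in> K \<Longrightarrow> 0 \<le> \<omega> \<bullet> y" using C(1) by (auto simp: dual_cone_def)
  have zoutendijk: "summable (\<lambda>k. (p k)\<^sup>2 / (n k)\<^sup>2)"
  proof (rule zoutendijk_summable[of p n _ "c1 * (\<omega> \<bullet> e)" t "\<lambda>k. \<omega> \<bullet> F (x k)" "\<omega> \<bullet> G"])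
    show "(1 - c2) / (M0 * L) > 0" using c12 M0(1) L(1) by simp
    show "c1 * (\<omega> \<bullet> e) > 0" using c12 e(2)[OF \<omega>] by simp
    show "\<omega> \<bullet> F (x (Suc k)) \<le> \<omega> \<bullet> F (x k) + c1 * (\<omega> \<bullet> e) * t k * p k" for k
      using \<omega>_dual[OF decrease[of k]] by (simp add: inner_diff_right inner_add_right algebra_simps)
    show "\<omega> \<bullet> G \<le> \<omega> \<bullet> F (x k)" for k
      using \<omega>_dual[of "F (x k) - G"] G[of k] by (simp add: cone_le_def inner_diff_right)
  qed (fact p_neg n_pos step)+
  have "liminf (\<lambda>k. ereal (w k)) = 0"
  proof (rule liminf_norm_eq_0I[OF _ _ _ zoutendijk])
    show "0 \<le> w k" for k using w_pos[of k] by simp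
    \<comment> \<open>The constant combines \<open>p k \<le> a k / (1 + c2)\<close> with
      \<open>a k \<le> - (w k)\<^sup>2 / 2\<close>.\<close>
    show "1 / (2 * (1 + c2)) > 0" using c12 by simp
    show "p k \<le> - (1 / (2 * (1 + c2))) * (w k)\<^sup>2" for k
    proof -
      have "p k \<le> a k / (1 + c2)" by (rule p_le)
      also have "\<dots> \<le> (- (w k)\<^sup>2 / 2) / (1 + c2)" using a_le c12 by (intro divide_right_mono) auto
      finally show ?thesis by simp
    qed
    show "(\<Sum>k. ennreal (1 / (n k)\<^sup>2)) = \<infinity>" using divergent by (simp add: n_def)
  qed
  then show ?thesis by (simp add: w_def)
qed

end
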